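(* Let $S$ be a GCD closed set of $9$ positive integers such that $(S,\mid)$ is isomorphic to the meet semilattice $9_K$ defined in the context. Then the LCM matrix $[S]$ is nonsingular.
   Context: A finite set $S=\{x_1,\ldots,x_n\}$ of distinct positive integers is GCD closed if $\gcd(x_i,x_j)\in S$ for all $i,j$. Then $(S,\mid)$, i.e. $S$ ordered by divisibility, is a meet semilattice with meet $\gcd$. The LCM matrix $[S]$ is the $n\times n$ matrix whose $ij$ entry is $\mathrm{lcm}(x_i,x_j)$. Let $Q$ be the $8$-element cube semilattice (the Boolean lattice of subsets of a three-element set), with bottom element $0$, three atoms, three coatoms and a top element. The $9$-element meet semilattice $9_K$ is obtained from $Q$ by inserting one new element $e$ between the bottom element $0$ and one of the atoms $a$: $0<e<a$, where $e$ covers only $0$ and is covered only by $a$, and all order relations of $Q$ are kept with no further relations among elements of $Q$. *)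

theory Defs
  imports Complex_Main "Jordan_Normal_Form.Matrix"
begin

definition gcd_closed :: "nat set \<Rightarrow> bool" where
  "gcd_closed S \<longleftrightarrow> finite S \<and> (\<forall>x\<in>S. 0 < x) \<and> (\<forall>x\<in>S. \<forall>y\<in>S. gcd x y \<in> S)"

(* Over the reals, so that invertible_mat means nonsingular rather than unimodular. *)
definition lcm_matrix :: "nat \<Rightarrow> (nat \<Rightarrow> nat) \<Rightarrow> real mat" where
  "lcm_matrix n x = mat n n (\<lambda>(i, j). of_nat (lcm (x i) (x j)))"

definition order_isomorphic ::
    "'a set \<Rightarrow> ('a \<Rightarrow> 'a \<Rightarrow> bool) \<Rightarrow> 'b set \<Rightarrow> ('b \<Rightarrow> 'b \<Rightarrow> bool) \<Rightarrow> bool" where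
  "order_isomorphic A leA B leB \<longleftrightarrow>
     (\<exists>f. bij_betw f A B \<and> (\<forall>x\<in>A. \<forall>y\<in>A. leA x y \<longleftrightarrow> leB (f x) (f y)))"

(* The cube Q consists of the Cube A with A a subset of {1,2,3}; the atom above
   the inserted element Extra is Cube {1}. *)
datatype nine_elem = Cube "nat set" | Extra

definition nineK :: "nine_elem set" where
  "nineK = insert Extra (Cube ` Pow {1, 2, 3})"

(* By transitivity, Extra < Cube {1} puts Extra below every Cube B with 1 in B. *)
fun nineK_le :: "nine_elem \<Rightarrow> nine_elem \<Rightarrow> bool" where
  "nineK_le (Cube A) (Cube B) \<longleftrightarrow> A \<subseteq> B"
| "nineK_le (Cube A) Extra \<longleftrightarrow> A = {}"
| "nineK_le Extra (Cube B) \<longleftrightarrow> 1 \<in> B"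
| "nineK_le Extra Extra \<longleftrightarrow> True"

lemma card_nineK: "card nineK = 9"
proof -
  have "card (Cube ` Pow {1, 2, 3}) = card (Pow {1, 2, 3 :: nat})"
    by (rule card_image) (auto simp: inj_on_def)
  moreover have "Extra \<notin> Cube ` Pow {1, 2, 3}" by auto
  ultimately show ?thesis by (simp add: nineK_def card_Pow)
qed

lemma nineK_refl: "nineK_le u u"
  by (cases u) auto

lemma nineK_antisym: "nineK_le u v \<Longrightarrow> nineK_le v u \<Longrightarrow> u = v"
  by (cases u; cases v) auto

lemma nineK_trans: "nineK_le u v \<Longrightarrow> nineK_le v w \<Longrightarrow> nineK_le u w"
  by (cases u; cases v; cases w) auto

lemma nineK_meet:
  assumes "u \<in> nineK" "v \<in> nineK"
  shows "\<exists>m\<in>nineK. \<forall>w\<in>nineK. nineK_le w m \<longleftrightarrow> nineK_le w u \<and> nineK_le w v"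
proof -
  have E: "\<exists>m\<in>nineK. \<forall>w\<in>nineK. nineK_le w m \<longleftrightarrow> nineK_le w Extra \<and> nineK_le w v"
    if "v \<in> nineK" for v
  proof (cases "nineK_le Extra v")
    case True
    show ?thesis
      by (rule bexI[of _ Extra]) (auto simp: nineK_def intro: nineK_trans[OF _ True])
  next
    case False
    then obtain B where B: "v = Cube B" "1 \<notin> B"
      by (cases v) auto
    have "nineK_le w (Cube {}) \<longleftrightarrow> nineK_le w Extra \<and> nineK_le w v" for w
      using B by (cases w) auto
    moreover have "Cube {} \<in> nineK" by (simp add: nineK_def)
    ultimately show ?thesis by blast
  qed
  show ?thesis
  proof (cases u)
    case Extra
    with E assms show ?thesis by simp
  next
    case (Cube A)
    show ?thesis
    proof (cases v)
      case Extra
      with E[OF assms(1)] show ?thesis by (simp add: conj_commute)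
    next
      case C: (Cube B)
      have "Cube (A \<inter> B) \<in> nineK"
        using assms Cube C by (auto simp: nineK_def)
      moreover have "nineK_le w (Cube (A \<inter> B)) \<longleftrightarrow> nineK_le w u \<and> nineK_le w v" for w
        using Cube C by (cases w) auto
      ultimately show ?thesis by blast
    qed
  qed
qed

definition nineK_covers :: "nine_elem \<Rightarrow> nine_elem \<Rightarrow> bool" where
  "nineK_covers v u \<longleftrightarrow> u \<in> nineK \<and> v \<in> nineK \<and> u \<noteq> v \<and> nineK_le u v \<and>
     (\<forall>w\<in>nineK. nineK_le u w \<and> nineK_le w v \<longrightarrow> w = u \<or> w = v)"

lemma Extra_covers_iff: "nineK_covers Extra u \<longleftrightarrow> u = Cube {}"
  by (cases u) (auto simp: nineK_covers_def nineK_def)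

lemma covers_Extra_iff: "nineK_covers v Extra \<longleftrightarrow> v = Cube {1}"
proof
  assume a: "nineK_covers v Extra"
  then obtain B where B: "v = Cube B" "1 \<in> B"
    by (cases v) (auto simp: nineK_covers_def)
  have "Cube {1} \<in> nineK" by (simp add: nineK_def)
  with a B show "v = Cube {1}" by (fastforce simp: nineK_covers_def)
qed (auto simp: nineK_covers_def nineK_def)

end

(* Writing lcm(x,y) = x y / gcd(x,y), the LCM matrix is nonsingular as soon as the Moebius inverse Psi
   of 1/x along (S,|) vanishes nowhere on S.  On 9_K only the top element t is delicate: the inserted
   element e does not contribute there, so with atoms a, b, c and coatoms p, q, r
     Psi(t) = 1/t - 1/p - 1/q - 1/r + 1/a + 1/b + 1/c - 1/o.
   After dividing by the bottom o, the atoms are pairwise coprime and, because of e, a/o is composite.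
   This forces 1/a + 1/b + 1/c <= 1/o, hence Psi(t) < 0. *)
theory Submission
  imports Defs "Jordan_Normal_Form.Determinant"
begin

section \<open>Nonsingularity from a nowhere vanishing Moebius inverse\<close>

lemma invertible_mat_of_trivial_kernel:
  fixes A :: "'a :: field mat"
  assumes A: "A \<in> carrier_mat n n"
    and ker: "\<And>v. v \<in> carrier_vec n \<Longrightarrow> A *\<^sub>v v = 0\<^sub>v n \<Longrightarrow> v = 0\<^sub>v n"
  shows "invertible_mat A"
proof -
  have "det A \<noteq> 0"
    using ker det_0_iff_vec_prod_zero[OF A] by blast
  \<comment> \<open>The parameter \<open>b\<close> merely fills the extension slot of the ring
    record.\<close>
  from det_non_zero_imp_unit[OF A this, where b = "()"]
  obtain B where "B \<in> carrier_mat n n" "A * B = 1\<^sub>m n" "B * A = 1\<^sub>m n"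
    by (auto simp: Units_def ring_mat_def)
  with A show ?thesis
    by (auto simp: invertible_mat_def inverts_mat_def)
qed

text \<open>This is the factorization D E diag(\<Psi>) E^T D of the LCM matrix, read on a kernel
  vector: D is the diagonal matrix of the elements of \<open>S\<close> and E the divisibility
  matrix. Both E and E^T are triangular, so the vector is removed in two passes, upwards for
  \<open>W\<close> and downwards for \<open>w\<close>.\<close>

lemma lcm_kernel_trivial:
  fixes v \<Psi> :: "nat \<Rightarrow> real"
  assumes S: "gcd_closed S"
    and inv: "\<And>s. s \<in> S \<Longrightarrow> (\<Sum>d\<in>{d\<in>S. d dvd s}. \<Psi> d) = 1 / real s"
    and nz: "\<And>s. s \<in> S \<Longrightarrow> \<Psi> s \<noteq> 0"
    and ker: "\<And>y. y \<in> S \<Longrightarrow> (\<Sum>s\<in>S. real (lcm y s) * v s) = 0"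
    and s: "s \<in> S"
  shows "v s = 0"
proof -
  have fin: "finite S" and pos: "\<And>s. s \<in> S \<Longrightarrow> s > 0"
    and gcd: "\<And>s y. s \<in> S \<Longrightarrow> y \<in> S \<Longrightarrow> gcd s y \<in> S"
    using S by (auto simp: gcd_closed_def)
  define w where "w s = real s * v s" for s
  define W where "W d = (\<Sum>s\<in>{s\<in>S. d dvd s}. w s)" for d
  have sum0: "(\<Sum>d\<in>{d\<in>S. d dvd y}. \<Psi> d * W d) = 0" if y: "y \<in> S" for y
  proof -
    have lcm: "real (lcm y s) * v s = real y * (\<Sum>d\<in>S. if d dvd y \<and> d dvd s then \<Psi> d * w s else 0)"
      if "s \<in> S" for s
    proof -
      have "real (lcm y s) * real (gcd y s) = real y * real s"
        by (metis of_nat_mult lcm_gcd_prod mult.commute prod_gcd_lcm_nat)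
      moreover have "real (gcd y s) \<noteq> 0" using pos[OF y] by simp
      ultimately have "real (lcm y s) = real y * real s * (1 / real (gcd y s))"
        by (simp add: field_simps)
      \<comment> \<open>GCD closure allows \<open>inv\<close> at \<open>gcd y s\<close>, whose
        divisors are exactly the common divisors of \<open>y\<close> and \<open>s\<close>.\<close>
      also have "1 / real (gcd y s) = (\<Sum>d\<in>S. if d dvd y \<and> d dvd s then \<Psi> d else 0)"
        using inv[OF gcd[OF y that]] fin by (simp add: sum.inter_filter)
      finally have "real (lcm y s) * v s = real y * ((\<Sum>d\<in>S. if d dvd y \<and> d dvd s then \<Psi> d else 0) * w s)"
        by (simp add: w_def)
      also have "(\<Sum>d\<in>S. if d dvd y \<and> d dvd s then \<Psi> d else 0) * w s
          = (\<Sum>d\<in>S. if d dvd y \<and> d dvd s then \<Psi> d * w s else 0)"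
        by (auto simp: sum_distrib_right intro!: sum.cong)
      finally show ?thesis .
    qed
    have "0 = real y * (\<Sum>s\<in>S. \<Sum>d\<in>S. if d dvd y \<and> d dvd s then \<Psi> d * w s else 0)"
      using ker[OF y] lcm by (simp add: sum_distrib_left)
    also have "(\<Sum>s\<in>S. \<Sum>d\<in>S. if d dvd y \<and> d dvd s then \<Psi> d * w s else 0)
        = (\<Sum>d\<in>S. \<Sum>s\<in>S. if d dvd y \<and> d dvd s then \<Psi> d * w s else 0)"
      by (rule sum.swap)
    also have "\<dots> = (\<Sum>d\<in>S. if d dvd y then \<Psi> d * W d else 0)"
      using fin by (auto simp: W_def sum.inter_filter sum_distrib_left intro!: sum.cong)
    also have "\<dots> = (\<Sum>d\<in>{d\<in>S. d dvd y}. \<Psi> d * W d)"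
      using fin by (simp add: sum.inter_filter)
    finally show ?thesis using pos[OF y] by simp
  qed
  \<comment> \<open>By induction the proper divisors of \<open>y\<close> drop out of
    \<open>sum0\<close>, leaving \<open>\<Psi> y * W y = 0\<close>.\<close>
  have W0: "y \<in> S \<Longrightarrow> W y = 0" for y
  proof (induction y rule: less_induct)
    case (less y)
    have "(\<Sum>d\<in>{d\<in>S. d dvd y}. \<Psi> d * W d) = (\<Sum>d\<in>{y}. \<Psi> d * W d)"
      using fin less pos by (intro sum.mono_neutral_right) (auto, metis dvd_imp_le le_neq_implies_less)
    with sum0[OF less.prems] nz[OF less.prems] show ?case by simp
  qed
  have "{s\<in>S. w s \<noteq> 0} = {}"
  proof (rule ccontr)
    assume ne: "{s\<in>S. w s \<noteq> 0} \<noteq> {}"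
    \<comment> \<open>Every proper multiple of \<open>m\<close> in \<open>S\<close> is larger than
      \<open>m\<close>, hence outside the support of \<open>w\<close>, so \<open>W m\<close>
      collapses to \<open>w m\<close>.\<close>
    define m where "m = Max {s\<in>S. w s \<noteq> 0}"
    have m: "m \<in> S" "w m \<noteq> 0"
      using Max_in[OF _ ne] fin by (auto simp: m_def)
    have "W m = (\<Sum>s\<in>{m}. w s)"
      unfolding W_def
    proof (intro sum.mono_neutral_right ballI)
      fix s assume a: "s \<in> {s\<in>S. m dvd s} - {m}"
      then have "m < s" using pos by (auto simp: dvd_imp_le le_neq_implies_less)
      moreover have "w s \<noteq> 0 \<Longrightarrow> s \<le> m"
        using a fin by (auto simp: m_def)
      ultimately show "w s = 0" by auto
    qed (use fin m in auto)
    with W0 m show False by simp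
  qed
  with s pos[OF s] show ?thesis by (auto simp: w_def)
qed

lemma invertible_lcm_matrix:
  fixes \<Psi> :: "nat \<Rightarrow> real"
  assumes S: "gcd_closed S"
    and inv: "\<And>s. s \<in> S \<Longrightarrow> (\<Sum>d\<in>{d\<in>S. d dvd s}. \<Psi> d) = 1 / real s"
    and nz: "\<And>s. s \<in> S \<Longrightarrow> \<Psi> s \<noteq> 0"
    and x: "bij_betw x {..<n} S"
  shows "invertible_mat (lcm_matrix n x)"
proof (rule invertible_mat_of_trivial_kernel)
  show "lcm_matrix n x \<in> carrier_mat n n" by (simp add: lcm_matrix_def)
  fix v assume v: "v \<in> carrier_vec n" and ker: "lcm_matrix n x *\<^sub>v v = 0\<^sub>v n"
  \<comment> \<open>Reading the coordinates of \<open>v\<close> as a function on \<open>S\<close>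
    removes the enumeration \<open>x\<close> from the kernel condition.\<close>
  define u where "u s = v $ inv_into {..<n} x s" for s
  have u: "u (x j) = v $ j" if "j < n" for j
    using x that by (simp add: u_def bij_betw_def)
  have "(\<Sum>s\<in>S. real (lcm y s) * u s) = 0" if "y \<in> S" for y
  proof -
    obtain i where i: "i < n" "y = x i"
      using \<open>y \<in> S\<close> x by (auto simp: bij_betw_def)
    have "(\<Sum>s\<in>S. real (lcm y s) * u s) = (\<Sum>j<n. real (lcm y (x j)) * u (x j))"
      by (rule sum.reindex_bij_betw[OF x, symmetric])
    also have "\<dots> = (lcm_matrix n x *\<^sub>v v) $ i"
      using i v u by (auto simp: lcm_matrix_def scalar_prod_def atLeast0LessThan intro!: sum.cong)
    finally show ?thesis using ker i by simp
  qed
  then have "u s = 0" if "s \<in> S" for s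
    using lcm_kernel_trivial[OF S inv nz] that by blast
  then show "v = 0\<^sub>v n"
    using v u x by (intro eq_vecI) (auto simp: bij_betw_def)
qed

section \<open>Bounds on sums of reciprocals\<close>

lemma proper_multiple_factor:
  fixes d a :: nat
  assumes "d dvd a" "d \<noteq> a" "0 < a"
  obtains k where "a = d * k" "2 \<le> k"
proof -
  obtain k where k: "a = d * k" using assms(1) by blast
  with assms have "k \<noteq> 0" "k \<noteq> 1" by auto
  then have "2 \<le> k" by simp
  with k that show thesis by blast
qed

text \<open>A proper multiple of \<open>d\<close> is at least \<open>2 * d\<close>, so each
  reciprocal is at most half of \<open>1 / d\<close>. This makes the Moebius values at the coatoms
  positive.\<close>

lemma inverse_sum_two_le:
  fixes d a b :: nat
  assumes "0 < a" "0 < b" "d dvd a" "d dvd b" "d \<noteq> a" "d \<noteq> b"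
  shows "1 / real a + 1 / real b \<le> 1 / real d"
proof -
  obtain k l where kl: "a = d * k" "2 \<le> k" "b = d * l" "2 \<le> l"
    using assms by (metis proper_multiple_factor)
  have "1 / real k \<le> 1 / 2" "1 / real l \<le> 1 / 2"
    using kl by (simp_all add: field_simps)
  then have "(1 / real k + 1 / real l) / real d \<le> 1 / real d"
    by (intro divide_right_mono) auto
  with kl show ?thesis by (simp add: add_divide_distrib mult.commute)
qed

text \<open>Compositeness of the first number is essential: 2, 3, 5 are pairwise coprime, yet 1/2 +
  1/3 + 1/5 = 31/30.\<close>

lemma inverse_sum_coprime_composite:
  fixes E k b c :: nat
  assumes "2 \<le> E" "2 \<le> k" "2 \<le> b" "2 \<le> c"
    and "coprime (E * k) b" "coprime (E * k) c" "coprime b c"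
  shows "1 / real (E * k) + 1 / real b + 1 / real c \<le> 1"
\<comment> \<open>From 6 on, distinctness of \<open>b\<close> and \<open>c\<close> suffices, by 1/6
  + 1/2 + 1/3 = 1. Below 6 the only product is 4, which forces \<open>b\<close> and \<open>c\<close>
  to be odd, and 1/4 + 1/3 + 1/3 < 1.\<close>
proof (cases "6 \<le> E * k")
  case True
  have "b \<noteq> c" using assms by auto
  then have three: "3 \<le> b \<or> 3 \<le> c" using assms by linarith
  have half: "1 / real m \<le> 1 / 2" if "2 \<le> m" for m
    using that by (simp add: field_simps)
  have third: "1 / real m \<le> 1 / 3" if "3 \<le> m" for m
    using that by (simp add: field_simps)
  have "1 / real b + 1 / real c \<le> 1 / 2 + 1 / 3"
    using three half[of b] half[of c] third[of b] third[of c] assms(3,4) by linarith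
  moreover have "1 / real (E * k) \<le> 1 / 6"
    using True frac_le[of 1 1 6 "real (E * k)"] by (simp del: of_nat_mult)
  ultimately show ?thesis by simp
next
  case False
  have "E < 3" using False assms mult_le_mono[of 3 E 2 k] by linarith
  moreover have "k < 3" using False assms mult_le_mono[of 2 E 3 k] by linarith
  ultimately have Ek: "E = 2" "k = 2" using assms by auto
  have "coprime 2 b" "coprime 2 c"
    using assms(5,6) unfolding Ek coprime_mult_left_iff by simp_all
  then have "b \<noteq> 2" "c \<noteq> 2" by auto
  then have "1 / real b \<le> 1 / 3" "1 / real c \<le> 1 / 3"
    using assms by (simp_all add: field_simps)
  then show ?thesis by (simp add: Ek)
qed

text \<open>Dividing by \<open>d\<close> turns the gcd conditions into pairwise coprimality, and
  \<open>e\<close> strictly between \<open>d\<close> and \<open>a\<close> splits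
  \<open>a / d\<close> into two factors of size at least 2.\<close>

lemma inverse_sum_three_le:
  fixes d e a b c :: nat
  assumes "0 < a" "0 < b" "0 < c" "d dvd e" "d \<noteq> e" "e dvd a" "e \<noteq> a"
    and "gcd a b = d" "gcd a c = d" "gcd b c = d" "d \<noteq> b" "d \<noteq> c"
  shows "1 / real a + 1 / real b + 1 / real c \<le> 1 / real d"
proof -
  have d: "0 < d" using assms by auto
  have e: "0 < e" using assms by (metis dvd_pos_nat)
  obtain k where k: "a = e * k" "2 \<le> k"
    using assms by (metis proper_multiple_factor)
  obtain E where E: "e = d * E" "2 \<le> E"
    using assms e by (metis proper_multiple_factor)
  obtain B where B: "b = d * B" "2 \<le> B"
    using assms by (metis proper_multiple_factor gcd_dvd2)
  obtain C where C: "c = d * C" "2 \<le> C"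
    using assms by (metis proper_multiple_factor gcd_dvd2)
  have a: "a = d * (E * k)" using k E by simp
  have "coprime (E * k) B" "coprime (E * k) C" "coprime B C"
    using assms(8-10) d unfolding a B(1) C(1) gcd_mult_distrib_nat[symmetric]
    by (auto simp: coprime_iff_gcd_eq_1)
  with inverse_sum_coprime_composite E k B C
  have "1 / real (E * k) + 1 / real B + 1 / real C \<le> 1" by blast
  then have "(1 / real (E * k) + 1 / real B + 1 / real C) / real d \<le> 1 / real d"
    by (intro divide_right_mono) auto
  then show ?thesis
    by (simp add: a B(1) C(1) add_divide_distrib mult.commute mult.left_commute)
qed

section \<open>Moebius inversion on 9_K\<close>

lemma nineK_eq:
  "nineK = {Extra, Cube {}, Cube {1}, Cube {2}, Cube {3}, Cube {1, 2}, Cube {1, 3}, Cube {2, 3},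
    Cube {1, 2, 3}}"
  by (auto simp: nineK_def Pow_insert)

(* No correction term for Extra is needed above Cube {1}: Extra has one cover only, so its Moebius
   value to every element beyond that cover is 0. *)
fun nineK_moebius :: "(nine_elem \<Rightarrow> real) \<Rightarrow> nine_elem \<Rightarrow> real" where
  "nineK_moebius y Extra = y Extra - y (Cube {})"
| "nineK_moebius y (Cube A) =
    (if A = {1} then y (Cube {1}) - y Extra
     else (\<Sum>B\<in>Pow A. (-1) ^ card (A - B) * y (Cube B)))"

lemma numeral_set_neqs:
  "{1::nat} \<noteq> {2}" "{1::nat} \<noteq> {3}" "{2::nat} \<noteq> {3}"
  "{1::nat, 2} \<noteq> {1, 3}" "{1::nat, 2} \<noteq> {2, 3}" "{1::nat, 3} \<noteq> {2, 3}"
  "{1::nat, 2, 3} \<noteq> {1, 2}" "{1::nat, 2, 3} \<noteq> {1, 3}" "{1::nat, 2, 3} \<noteq> {2, 3}"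
  by (simp_all add: set_eq_iff) presburger+

lemma nineK_moebius_simps:
  "nineK_moebius y (Cube {}) = y (Cube {})"
  "nineK_moebius y (Cube {1}) = y (Cube {1}) - y Extra"
  "nineK_moebius y (Cube {2}) = y (Cube {2}) - y (Cube {})"
  "nineK_moebius y (Cube {3}) = y (Cube {3}) - y (Cube {})"
  "nineK_moebius y (Cube {1, 2}) = y (Cube {1, 2}) - y (Cube {1}) - y (Cube {2}) + y (Cube {})"
  "nineK_moebius y (Cube {1, 3}) = y (Cube {1, 3}) - y (Cube {1}) - y (Cube {3}) + y (Cube {})"
  "nineK_moebius y (Cube {2, 3}) = y (Cube {2, 3}) - y (Cube {2}) - y (Cube {3}) + y (Cube {})"
  "nineK_moebius y (Cube {1, 2, 3}) = y (Cube {1, 2, 3}) - y (Cube {1, 2}) - y (Cube {1, 3})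
     - y (Cube {2, 3}) + y (Cube {1}) + y (Cube {2}) + y (Cube {3}) - y (Cube {})"
  by (simp_all add: Pow_insert numeral_set_neqs insert_Diff_if doubleton_eq_iff del: One_nat_def)

text \<open>The values at \<open>Extra\<close> and \<open>Cube {1}\<close> telescope to
  \<open>y (Cube {1}) - y (Cube {})\<close>, the value of an ordinary atom, so above
  \<open>Cube {1}\<close> the sums agree with those of the cube.\<close>

lemma nineK_moebius_sum:
  assumes "u \<in> nineK"
  shows "(\<Sum>w\<in>{w\<in>nineK. nineK_le w u}. nineK_moebius y w) = y u"
proof -
  have fin: "finite nineK" by (simp add: nineK_eq)
  have mem: "(\<Sum>w\<in>nineK. F w) = F Extra + F (Cube {}) + F (Cube {1}) + F (Cube {2}) + F (Cube {3})
    + F (Cube {1, 2}) + F (Cube {1, 3}) + F (Cube {2, 3}) + F (Cube {1, 2, 3})" for F :: "nine_elem \<Rightarrow> real"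
    unfolding nineK_eq
    by (simp add: numeral_set_neqs doubleton_eq_iff insert_eq_iff)
  show ?thesis
    using assms[unfolded nineK_eq]
    by (elim insertE emptyE)
      (simp_all add: sum.inter_filter[OF fin] mem nineK_moebius_simps del: nineK_moebius.simps(2) One_nat_def)
qed

theorem mainTheorem2:
  fixes S :: "nat set" and x :: "nat \<Rightarrow> nat"
  assumes "gcd_closed S"
    and "card S = 9"
    and "order_isomorphic S (dvd) nineK nineK_le"
    and "bij_betw x {..<9} S"
  shows "invertible_mat (lcm_matrix 9 x)"
proof -
  obtain f where f: "bij_betw f S nineK"
    and f_le: "\<And>s t. s \<in> S \<Longrightarrow> t \<in> S \<Longrightarrow> s dvd t \<longleftrightarrow> nineK_le (f s) (f t)"
    using assms(3) by (auto simp: order_isomorphic_def)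
  define g where "g = inv_into S f"
  have gS: "g u \<in> S" and fg: "f (g u) = u" if "u \<in> nineK" for u
    using f that by (auto simp: g_def bij_betw_def inv_into_into f_inv_into_f)
  have gf: "g (f s) = s" and fS: "f s \<in> nineK" if "s \<in> S" for s
    using f that by (auto simp: g_def bij_betw_def)
  have g_dvd: "g u dvd g w \<longleftrightarrow> nineK_le u w" if "u \<in> nineK" "w \<in> nineK" for u w
    using f_le gS fg that by simp
  have g_pos: "0 < g u" if "u \<in> nineK" for u
    using gS[OF that] assms(1) by (auto simp: gcd_closed_def)
  have g_eq: "g u = g w \<longleftrightarrow> u = w" if "u \<in> nineK" "w \<in> nineK" for u w
    using fg that by metis
  \<comment> \<open>The gcd lies in \<open>S\<close>, so it is the image under \<open>g\<close> of a
    lower bound of \<open>u\<close> and \<open>w\<close>, and the order isomorphism places it below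
    \<open>g m\<close>.\<close>
  have g_gcd: "gcd (g u) (g w) = g m"
    if "u \<in> nineK" "w \<in> nineK" "m \<in> nineK"
      and meet: "\<And>z. z \<in> nineK \<Longrightarrow> nineK_le z u \<and> nineK_le z w \<longleftrightarrow> nineK_le z m" for u w m
  proof (rule dvd_antisym)
    have d: "gcd (g u) (g w) \<in> S" using gS that assms(1) by (auto simp: gcd_closed_def)
    let ?z = "f (gcd (g u) (g w))"
    have z: "?z \<in> nineK" "g ?z = gcd (g u) (g w)" using fS gf d by auto
    have "g ?z dvd g u" "g ?z dvd g w" by (simp_all add: z)
    then show "gcd (g u) (g w) dvd g m" using g_dvd meet that z by metis
    show "g m dvd gcd (g u) (g w)"
      using g_dvd meet[of m] that nineK_refl[of m] by auto
  qed
  define y where "y u = 1 / real (g u)" for u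
  have y_pos: "0 < y u" if "u \<in> nineK" for u
    using g_pos that by (simp add: y_def)
  have y_neq: "y u \<noteq> y w" if "u \<in> nineK" "w \<in> nineK" "u \<noteq> w" for u w
    using g_eq that by (simp add: y_def)
  have two: "y u + y w \<le> y (Cube {})"
    if "u \<in> nineK" "w \<in> nineK" "u \<noteq> Cube {}" "w \<noteq> Cube {}" for u w
  proof -
    have b: "Cube {} \<in> nineK" by (simp add: nineK_eq)
    have "nineK_le (Cube {}) u" "nineK_le (Cube {}) w"
      by (cases u; simp) (cases w; simp)
    then show ?thesis
      unfolding y_def using that b g_pos g_dvd g_eq by (intro inverse_sum_two_le) metis+
  qed
  have three: "y (Cube {1}) + y (Cube {2}) + y (Cube {3}) \<le> y (Cube {})"
    unfolding y_def
  proof (rule inverse_sum_three_le[where e = "g Extra"])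
    show "gcd (g (Cube {1})) (g (Cube {2})) = g (Cube {})"
      "gcd (g (Cube {1})) (g (Cube {3})) = g (Cube {})"
      "gcd (g (Cube {2})) (g (Cube {3})) = g (Cube {})"
      by (rule g_gcd; auto simp: nineK_eq)+
  qed (auto simp: g_pos g_dvd g_eq nineK_eq)
  \<comment> \<open>In the Moebius value at the top, this coatom outweighs the top term;
    \<open>three\<close> and the positivity of the other two coatom terms then make the total
    negative.\<close>
  have top: "y (Cube {1, 2, 3}) < y (Cube {1, 2})"
  proof -
    have "g (Cube {1, 2}) dvd g (Cube {1, 2, 3})" "g (Cube {1, 2}) \<noteq> g (Cube {1, 2, 3})"
      by (subst g_dvd g_eq; auto simp: nineK_eq)+
    moreover have pos: "0 < g (Cube {1, 2})" "0 < g (Cube {1, 2, 3})"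
      by (rule g_pos; simp add: nineK_eq)+
    ultimately have "g (Cube {1, 2}) < g (Cube {1, 2, 3})"
      by (metis dvd_imp_le le_neq_implies_less)
    with pos(1) show ?thesis
      unfolding y_def by (intro divide_strict_left_mono) simp_all
  qed
  show ?thesis
  proof (rule invertible_lcm_matrix[where \<Psi> = "\<lambda>s. nineK_moebius y (f s)", OF assms(1) _ _ assms(4)])
    fix s assume s: "s \<in> S"
    \<comment> \<open>The divisors of \<open>s\<close> in \<open>S\<close> correspond to the
      down-set of \<open>f s\<close>, which carries the inversion formula over to
      \<open>S\<close>.\<close>
    have "bij_betw f {d\<in>S. d dvd s} {w\<in>nineK. nineK_le w (f s)}"
      by (rule bij_betw_byWitness[where f' = g]) (use gf fg gS fS f_le s in auto)
    from sum.reindex_bij_betw[OF this, of "nineK_moebius y"]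
    show "(\<Sum>d\<in>{d\<in>S. d dvd s}. nineK_moebius y (f d)) = 1 / real s"
      using nineK_moebius_sum[OF fS[OF s]] gf[OF s] by (simp add: y_def)
  next
    fix s assume "s \<in> S"
    have mem: "Extra \<in> nineK" "Cube {} \<in> nineK" "Cube {1} \<in> nineK" "Cube {2} \<in> nineK"
      "Cube {3} \<in> nineK" "Cube {1, 2} \<in> nineK" "Cube {1, 3} \<in> nineK" "Cube {2, 3} \<in> nineK"
      by (simp_all add: nineK_eq)
    have "nineK_moebius y Extra \<noteq> 0"
      using y_neq[of Extra "Cube {}"] mem by simp
    moreover have "nineK_moebius y (Cube {}) \<noteq> 0"
      unfolding nineK_moebius_simps using y_pos mem by (metis less_irrefl)
    moreover have "nineK_moebius y (Cube {1}) \<noteq> 0"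
      unfolding nineK_moebius_simps using y_neq[of "Cube {1}" Extra] mem by simp
    moreover have "nineK_moebius y (Cube {2}) \<noteq> 0" "nineK_moebius y (Cube {3}) \<noteq> 0"
      unfolding nineK_moebius_simps
      using y_neq[of "Cube {2}" "Cube {}"] y_neq[of "Cube {3}" "Cube {}"] mem by simp_all
    \<comment> \<open>By \<open>two\<close>, the value at a coatom is at least the reciprocal of the
      coatom itself, hence positive.\<close>
    moreover have "nineK_moebius y (Cube {1, 2}) \<noteq> 0"
      unfolding nineK_moebius_simps
      using two[of "Cube {1}" "Cube {2}"] y_pos[OF mem(6)] mem(3,4) by simp
    moreover have "nineK_moebius y (Cube {1, 3}) \<noteq> 0"
      unfolding nineK_moebius_simps
      using two[of "Cube {1}" "Cube {3}"] y_pos[OF mem(7)] mem(3,5) by simp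
    moreover have "nineK_moebius y (Cube {2, 3}) \<noteq> 0"
      unfolding nineK_moebius_simps
      using two[of "Cube {2}" "Cube {3}"] y_pos[OF mem(8)] mem(4,5) by simp
    moreover have "nineK_moebius y (Cube {1, 2, 3}) \<noteq> 0"
      unfolding nineK_moebius_simps
      using three top y_pos[OF mem(7)] y_pos[OF mem(8)] by simp
    ultimately show "nineK_moebius y (f s) \<noteq> 0"
      using fS[OF \<open>s \<in> S\<close>] unfolding nineK_eq by (elim insertE emptyE) simp_all
  qed
qed

end
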